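(* Let $N \ge 2$, $\alpha \ge 1$ and $1 \le n < N$ be integers, and let $L_\varphi = \{\lambda_1,\dots,\lambda_N\}$ be a set of $N$ labels. Let $\alpha$ labelsets be drawn independently, each uniformly at random among the $n$-element subsets of $L_\varphi$. Let $P_s$ be the probability that every pair $\{\lambda_a,\lambda_b\}$ with $1\le a<b\le N$ is included in (i.e. is a subset of) at least one of the $\alpha$ drawn labelsets. Then $$P_s \le 1 - 2\,\frac{(\delta-1)S_1 - S_2}{\delta(\delta-1)},$$ where $$S_1 = \binom{N}{2}\left(\frac{\binom{N-2}{n} + 2\binom{N-2}{n-1}}{\binom{N}{n}}\right)^{\alpha},$$ $$S_2 = \frac{3\binom{N}{3}}{\binom{N}{n}^{\alpha}}\left(\frac{N-3}{4}\left(\binom{N-4}{n} + 4\binom{N-4}{n-1} + 4\binom{N-4}{n-2}\right)^{\alpha} + \left(\binom{N-3}{n} + 3\binom{N-3}{n-1} + \binom{N-3}{n-2}\right)^{\alpha}\right),$$ $$\delta = 2 + \left\lfloor \frac{2S_2}{S_1}\right\rfloor .$$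
   Context: Here $N$ is the total number of devices (one label per device), $n$ is the number of active devices, and a labelset is the set of labels of the active devices in one training sample, i.e. an $n$-element subset of the $N$ labels. Convention: $\binom{m}{k}=0$ unless $0\le k\le m$ (in particular it is $0$ when $m<0$). $\lfloor x\rfloor$ denotes the largest integer not exceeding $x$. *)

theory Defs
  imports "HOL-Probability.Probability"
begin

text \<open>
  Binomial coefficients with integer arguments, equal to 0 unless \<open>0 \<le> k \<le> m\<close>.
  The arguments are integers because expressions such as \<open>N - 4\<close> and \<open>n - 2\<close> below can be negative;
  truncated subtraction on \<^typ>\<open>nat\<close> would give wrong (nonzero) values, and \<open>gbinomial\<close>
  does not vanish for negative \<open>m\<close>.
\<close>
definition binom :: "int \<Rightarrow> int \<Rightarrow> nat" where
  "binom m k = (if 0 \<le> k \<and> k \<le> m then nat m choose nat k else 0)"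

definition labelsets :: "'l set \<Rightarrow> nat \<Rightarrow> 'l set set" where
  "labelsets L n = {A. A \<subseteq> L \<and> card A = n}"

text \<open>
  \<open>X 0, \<dots>, X (\<alpha> - 1)\<close> are random elements on the probability space \<open>M\<close> that are independent and
  each uniformly distributed on the \<open>n\<close>-element subsets of \<open>L\<close>.
\<close>
definition iid_uniform_labelsets ::
    "'w measure \<Rightarrow> nat \<Rightarrow> 'l set \<Rightarrow> nat \<Rightarrow> (nat \<Rightarrow> 'w \<Rightarrow> 'l set) \<Rightarrow> bool" where
  "iid_uniform_labelsets M \<alpha> L n X \<longleftrightarrow>
     prob_space.indep_vars M (\<lambda>_. count_space (labelsets L n)) X {..<\<alpha>} \<and>
     (\<forall>i<\<alpha>. distr M (count_space (labelsets L n)) (X i) = uniform_count_measure (labelsets L n))"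

definition S1 :: "nat \<Rightarrow> nat \<Rightarrow> nat \<Rightarrow> real" where
  "S1 N n \<alpha> = real (binom N 2) *
     ((real (binom (int N - 2) n) + 2 * real (binom (int N - 2) (int n - 1))) / real (binom N n)) ^ \<alpha>"

definition S2 :: "nat \<Rightarrow> nat \<Rightarrow> nat \<Rightarrow> real" where
  "S2 N n \<alpha> = 3 * real (binom N 3) / real (binom N n) ^ \<alpha> *
     ((real N - 3) / 4 *
        (real (binom (int N - 4) n) + 4 * real (binom (int N - 4) (int n - 1))
           + 4 * real (binom (int N - 4) (int n - 2))) ^ \<alpha>
      + (real (binom (int N - 3) n) + 3 * real (binom (int N - 3) (int n - 1))
           + real (binom (int N - 3) (int n - 2))) ^ \<alpha>)"

definition delta :: "nat \<Rightarrow> nat \<Rightarrow> nat \<Rightarrow> int" where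
  "delta N n \<alpha> = 2 + \<lfloor>2 * S2 N n \<alpha> / S1 N n \<alpha>\<rfloor>"

end

theory Submission
  imports Defs
begin

text \<open>
  Let \<open>k\<close> be the number of label pairs that no drawn labelset covers. For every integer \<open>d\<close>,
  \<open>(k - d) (k - (d - 1)) \<ge> 0\<close>, so that for \<open>d \<ge> 2\<close> the indicator of \<open>k \<ge> 1\<close> is at least
  \<open>2 ((d - 1) k - (k choose 2)) / (d (d - 1))\<close>. Taking expectations gives the Dawson--Sankoff bound,
  with \<open>S\<^sub>1\<close> the expectation of \<open>k\<close> and \<open>S\<^sub>2\<close> that of \<open>k choose 2\<close>. The expectations follow
  by independence from counting the labelsets that avoid one pair or two given pairs;
  two distinct pairs either are disjoint or share exactly one label.
\<close>

section \<open>Dawson--Sankoff lower bound for the probability of a union\<close>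

text \<open>If \<open>x\<close> lies in exactly \<open>k\<close> of the sets, both sides count the
  \<open>k * (k - 1)\<close> ordered pairs of distinct indices whose sets contain \<open>x\<close>.
  Leaving out \<open>j = i\<close> costs one only when \<open>x\<close> is in \<open>A i\<close>,
  because indicators are idempotent.\<close>

lemma sum_indicator_offdiag:
  assumes "finite I"
  shows "(\<Sum>i\<in>I. \<Sum>j\<in>I - {i}. indicator (A i \<inter> A j) x :: real)
       = (\<Sum>i\<in>I. indicator (A i) x) * ((\<Sum>i\<in>I. indicator (A i) x) - 1)"
proof -
  have "(\<Sum>j\<in>I - {i}. indicator (A i \<inter> A j) x :: real)
      = indicator (A i) x * ((\<Sum>j\<in>I. indicator (A j) x) - 1)" if "i \<in> I" for i
    using assms that
    by (simp add: indicator_inter_arith sum_diff1 flip: sum_distrib_left)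
       (simp add: indicator_def)
  then show ?thesis
    by (simp add: sum_distrib_right)
qed

text \<open>A pointwise inequality between indicators is integrated. The double sum runs over
  ordered pairs of indices, so half of it is the sum over unordered pairs. With \<open>d\<close>
  free, the particular value \<open>delta\<close> enters later only through being at least
  2.\<close>

lemma (in prob_space) dawson_sankoff:
  fixes d :: int
  assumes I: "finite I" and A: "\<And>i. i \<in> I \<Longrightarrow> A i \<in> events" and d: "2 \<le> d"
  shows "2 * ((real_of_int d - 1) * (\<Sum>i\<in>I. prob (A i))
             - (\<Sum>i\<in>I. \<Sum>j\<in>I - {i}. prob (A i \<inter> A j)) / 2) / (real_of_int d * (real_of_int d - 1))
       \<le> prob (\<Union>i\<in>I. A i)"
proof -
  define D where "D = real_of_int d"
  have D: "D \<ge> 2" using d by (simp add: D_def)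
  define s where "s x = (\<Sum>i\<in>I. indicator (A i) x :: real)" for x
  define q where "q x = (\<Sum>i\<in>I. \<Sum>j\<in>I - {i}. indicator (A i \<inter> A j) x :: real)" for x
  have le: "2 * ((D - 1) * s x - q x / 2) / (D * (D - 1)) \<le> indicator (\<Union>i\<in>I. A i) x" for x
  proof (cases "x \<in> (\<Union>i\<in>I. A i)")
    \<comment> \<open>Outside the union no indicator fires, so both sides are 0.\<close>
    case False
    then have "s x = 0"
      unfolding s_def by (intro sum.neutral) auto
    then show ?thesis
      using I False by (simp add: q_def sum_indicator_offdiag flip: s_def)
  next
    case True
    define k where "k = int (card {i\<in>I. x \<in> A i})"
    have s: "s x = real_of_int k"
      using I by (simp add: s_def k_def indicator_def of_bool_def sum.If_cases Int_def)
    have q: "q x = real_of_int k * (real_of_int k - 1)"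
      using I by (simp add: q_def sum_indicator_offdiag s flip: s_def)
    \<comment> \<open>The factors are consecutive integers, so they cannot have strictly opposite
      signs; this is where integrality of \<open>k\<close> and \<open>d\<close> enters. Expanded, it
      reads \<open>2 * (d - 1) * k - k * (k - 1) \<le> d * (d - 1)\<close>.\<close>
    have "(k - d) * (k - (d - 1)) \<ge> 0"
      by (cases "k \<ge> d") (auto intro: mult_nonneg_nonneg mult_nonpos_nonpos)
    then have "real_of_int ((k - d) * (k - (d - 1))) \<ge> 0"
      by (simp only: of_int_0_le_iff)
    then have "2 * ((D - 1) * s x - q x / 2) \<le> D * (D - 1)"
      by (simp add: s q D_def field_simps)
    then show ?thesis
      using D True by (simp add: divide_le_eq)
  qed
  have int[simp]: "integrable M (\<lambda>x. indicator (A i) x :: real)"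
    "integrable M (\<lambda>x. indicator (A i \<inter> A j) x :: real)" if "i \<in> I" "j \<in> I" for i j
    using A that by (auto simp: emeasure_eq_measure)
  have U: "(\<Union>i\<in>I. A i) \<in> events"
    using A I by auto
  have [simp]: "integrable M s" "integrable M q"
    unfolding s_def q_def by (auto intro!: Bochner_Integration.integrable_sum)
  have Es: "expectation s = (\<Sum>i\<in>I. prob (A i))"
    unfolding s_def using A by (subst Bochner_Integration.integral_sum) auto
  have Eq: "expectation q = (\<Sum>i\<in>I. \<Sum>j\<in>I - {i}. prob (A i \<inter> A j))"
  proof -
    have "expectation q = (\<Sum>i\<in>I. expectation (\<lambda>x. \<Sum>j\<in>I - {i}. indicator (A i \<inter> A j) x))"
      unfolding q_def by (intro Bochner_Integration.integral_sum Bochner_Integration.integrable_sum) auto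
    also have "\<dots> = (\<Sum>i\<in>I. \<Sum>j\<in>I - {i}. expectation (indicator (A i \<inter> A j)))"
      by (intro sum.cong Bochner_Integration.integral_sum refl) auto
    also have "\<dots> = (\<Sum>i\<in>I. \<Sum>j\<in>I - {i}. prob (A i \<inter> A j))"
      using A by (intro sum.cong refl) (auto simp: sets.Int)
    finally show ?thesis .
  qed
  have "expectation (\<lambda>x. 2 * ((D - 1) * s x - q x / 2) / (D * (D - 1)))
      \<le> expectation (indicator (\<Union>i\<in>I. A i))"
    using U by (intro integral_mono le) (auto simp: emeasure_eq_measure)
  then show ?thesis
    using U by (simp add: Es Eq D_def)
qed

section \<open>Counting labelsets by their trace on a fixed set\<close>

lemma binom_of_nat: "binom (int m) (int k) = m choose k"
  by (simp add: binom_def binomial_eq_0)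

lemma finite_labelsets: "finite L \<Longrightarrow> finite (labelsets L n)"
  by (simp add: labelsets_def)

lemma card_labelsets: "finite L \<Longrightarrow> card (labelsets L n) = card L choose n"
  by (simp add: labelsets_def n_subsets)

text \<open>A labelset with trace \<open>B\<close> on \<open>T\<close> is \<open>B\<close> together
  with a free choice of \<open>n - card B\<close> labels outside \<open>T\<close>.\<close>

lemma card_labelsets_trace:
  assumes L: "finite L" and T: "T \<subseteq> L" and B: "B \<subseteq> T"
  shows "card {A \<in> labelsets L n. A \<inter> T = B} = binom (int (card L) - card T) (int n - card B)"
proof (cases "card B \<le> n")
  case True
  have fin: "finite T" "finite B"
    using L T B by (auto intro: finite_subset)
  have "bij_betw (\<lambda>C. C \<union> B) (labelsets (L - T) (n - card B)) {A \<in> labelsets L n. A \<inter> T = B}"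
  proof (rule bij_betw_byWitness[where f' = "\<lambda>A. A - T"])
    show "(\<lambda>C. C \<union> B) ` labelsets (L - T) (n - card B) \<subseteq> {A \<in> labelsets L n. A \<inter> T = B}"
    proof safe
      fix C assume C: "C \<in> labelsets (L - T) (n - card B)"
      then have "C \<subseteq> L - T" "finite C" "card C = n - card B"
        using L by (auto simp: labelsets_def intro: finite_subset)
      moreover from this have "card (C \<union> B) = card C + card B"
        using B fin by (intro card_Un_disjoint) auto
      ultimately show "C \<union> B \<in> labelsets L n"
        using True B T by (auto simp: labelsets_def)
    qed (use B in \<open>auto simp: labelsets_def\<close>)
    show "(\<lambda>A. A - T) ` {A \<in> labelsets L n. A \<inter> T = B} \<subseteq> labelsets (L - T) (n - card B)"
      using fin by (auto simp: labelsets_def card_Diff_subset_Int)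
  qed (use B in \<open>auto simp: labelsets_def\<close>)
  then have "card {A \<in> labelsets L n. A \<inter> T = B} = card (L - T) choose (n - card B)"
    using L by (simp add: card_labelsets flip: bij_betw_same_card)
  then show ?thesis
    using True L T fin by (simp add: card_Diff_subset card_mono flip: binom_of_nat)
next
  \<comment> \<open>A trace cannot have more than \<open>n\<close> labels. The second argument of
    \<open>binom\<close> is then a negative integer and yields the required 0; truncated subtraction
    would make it 0 and could yield 1.\<close>
  case False
  have "\<not> (A \<subseteq> L \<and> card A = n \<and> A \<inter> T = B)" for A
    using False L by (metis card_mono finite_subset inf_le1)
  then have empty: "{A \<in> labelsets L n. A \<inter> T = B} = {}"
    by (auto simp: labelsets_def)
  show ?thesis
    unfolding empty using False by (simp add: binom_def)
qed

text \<open>Each labelset has exactly one trace on \<open>T\<close>, so the counts for different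
  traces add up. Counting labelsets that avoid given pairs thereby reduces to listing the permitted
  traces by size.\<close>

lemma card_labelsets_family:
  assumes L: "finite L" and T: "T \<subseteq> L" and F: "F \<subseteq> Pow T"
  shows "card {A \<in> labelsets L n. A \<inter> T \<in> F}
       = (\<Sum>B\<in>F. binom (int (card L) - card T) (int n - card B))"
proof -
  have "finite F"
    using L T F by (meson finite_Pow_iff finite_subset)
  moreover have "{A \<in> labelsets L n. A \<inter> T \<in> F} = (\<Union>B\<in>F. {A \<in> labelsets L n. A \<inter> T = B})"
    by auto
  ultimately have "card {A \<in> labelsets L n. A \<inter> T \<in> F}
      = (\<Sum>B\<in>F. card {A \<in> labelsets L n. A \<inter> T = B})"
    using finite_labelsets[OF L] by (simp only:) (rule card_UN_disjoint; auto)
  also have "\<dots> = (\<Sum>B\<in>F. binom (int (card L) - card T) (int n - card B))"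
    using F by (intro sum.cong refl card_labelsets_trace L T) auto
  finally show ?thesis .
qed

lemma card_avoid_pair:
  assumes L: "finite L" and e: "e \<in> labelsets L 2"
  shows "card {A \<in> labelsets L n. \<not> e \<subseteq> A}
       = binom (int (card L) - 2) n + 2 * binom (int (card L) - 2) (int n - 1)"
proof -
  obtain a b where ab: "e = {a, b}" "a \<noteq> b"
    using e by (auto simp: labelsets_def card_2_iff)
  \<comment> \<open>Every proper subset of \<open>e\<close> is a permitted trace: one empty set and
    two singletons.\<close>
  have "{A \<in> labelsets L n. \<not> e \<subseteq> A} = {A \<in> labelsets L n. A \<inter> e \<in> {{}, {a}, {b}}}"
    using ab by auto
  then show ?thesis
    using card_labelsets_family[OF L, of e "{{}, {a}, {b}}" n] e ab
    by (auto simp: labelsets_def)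
qed

lemma card_avoid_adjacent_pairs:
  assumes L: "finite L" and abc: "{a, b, c} \<subseteq> L" "a \<noteq> b" "a \<noteq> c" "b \<noteq> c"
  shows "card {A \<in> labelsets L n. \<not> {a, b} \<subseteq> A \<and> \<not> {a, c} \<subseteq> A}
       = binom (int (card L) - 3) n + 3 * binom (int (card L) - 3) (int n - 1)
         + binom (int (card L) - 3) (int n - 2)"
proof -
  \<comment> \<open>The permitted traces are all subsets of \<open>{b, c}\<close>, and
    \<open>{a}\<close> alone: once the shared label \<open>a\<close> is present, neither
    \<open>b\<close> nor \<open>c\<close> may be. By size there are 1, 3 and 1 of them.\<close>
  let ?F = "{{}, {a}, {b}, {c}, {b, c}}"
  have "{A \<in> labelsets L n. \<not> {a, b} \<subseteq> A \<and> \<not> {a, c} \<subseteq> A}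
      = {A \<in> labelsets L n. A \<inter> {a, b, c} \<in> ?F}"
  proof (intro Collect_cong conj_cong refl)
    fix A
    show "\<not> {a, b} \<subseteq> A \<and> \<not> {a, c} \<subseteq> A \<longleftrightarrow> A \<inter> {a, b, c} \<in> ?F"
      using abc(2-)
      by (cases "a \<in> A"; cases "b \<in> A"; cases "c \<in> A"; simp add: doubleton_eq_iff; fastforce)
  qed
  then have "card {A \<in> labelsets L n. \<not> {a, b} \<subseteq> A \<and> \<not> {a, c} \<subseteq> A}
      = (\<Sum>B\<in>?F. binom (int (card L) - card {a, b, c}) (int n - card B))"
    by (simp only:) (intro card_labelsets_family L abc, auto)
  also have "\<dots> = binom (int (card L) - 3) n + 3 * binom (int (card L) - 3) (int n - 1)
         + binom (int (card L) - 3) (int n - 2)"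
    using abc(2-) by (simp add: doubleton_eq_iff)
  finally show ?thesis .
qed

lemma card_avoid_disjoint_pairs:
  assumes L: "finite L" and abcd: "{a, b, c, d} \<subseteq> L"
      "a \<noteq> b" "a \<noteq> c" "a \<noteq> d" "b \<noteq> c" "b \<noteq> d" "c \<noteq> d"
  shows "card {A \<in> labelsets L n. \<not> {a, b} \<subseteq> A \<and> \<not> {c, d} \<subseteq> A}
       = binom (int (card L) - 4) n + 4 * binom (int (card L) - 4) (int n - 1)
         + 4 * binom (int (card L) - 4) (int n - 2)"
proof -
  \<comment> \<open>A permitted trace takes at most one label from each pair, giving 3 * 3
    possibilities: 1, 4 and 4 by size.\<close>
  let ?F = "{{}, {a}, {b}, {c}, {d}, {a, c}, {a, d}, {b, c}, {b, d}}"
  have "{A \<in> labelsets L n. \<not> {a, b} \<subseteq> A \<and> \<not> {c, d} \<subseteq> A}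
      = {A \<in> labelsets L n. A \<inter> {a, b, c, d} \<in> ?F}"
  proof (intro Collect_cong conj_cong refl)
    fix A
    show "\<not> {a, b} \<subseteq> A \<and> \<not> {c, d} \<subseteq> A \<longleftrightarrow> A \<inter> {a, b, c, d} \<in> ?F"
      using abcd(2-)
      by (cases "a \<in> A"; cases "b \<in> A"; cases "c \<in> A"; cases "d \<in> A";
          simp add: doubleton_eq_iff; fastforce)
  qed
  then have "card {A \<in> labelsets L n. \<not> {a, b} \<subseteq> A \<and> \<not> {c, d} \<subseteq> A}
      = (\<Sum>B\<in>?F. binom (int (card L) - card {a, b, c, d}) (int n - card B))"
    by (simp only:) (intro card_labelsets_family L abcd, auto)
  also have "\<dots> = binom (int (card L) - 4) n + 4 * binom (int (card L) - 4) (int n - 1)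
         + 4 * binom (int (card L) - 4) (int n - 2)"
    using abcd(2-) by (simp add: doubleton_eq_iff)
  finally show ?thesis .
qed

section \<open>Disjoint and adjacent pairs of labels\<close>

text \<open>A pair other than \<open>e\<close> either avoids \<open>e\<close> and is chosen from the
  remaining labels, or shares one of the two labels of \<open>e\<close> and takes its second label
  from the remaining ones.\<close>

lemma sum_over_other_pairs:
  fixes g :: "'l set \<Rightarrow> real"
  assumes L: "finite L" and e: "e \<in> labelsets L 2"
    and disj: "\<And>f. f \<in> labelsets L 2 \<Longrightarrow> e \<inter> f = {} \<Longrightarrow> g f = u"
    and adj: "\<And>f. f \<in> labelsets L 2 \<Longrightarrow> card (e \<inter> f) = 1 \<Longrightarrow> g f = v"
  shows "(\<Sum>f\<in>labelsets L 2 - {e}. g f)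
       = real ((card L - 2) choose 2) * u + 2 * (real (card L) - 2) * v"
proof -
  have eL: "e \<subseteq> L" "card e = 2" "finite e"
    using e L by (auto simp: labelsets_def intro: finite_subset)
  then have cL: "card L \<ge> 2"
    using L card_mono by metis
  let ?D = "{f \<in> labelsets L 2. f \<inter> e = {}}" and ?J = "\<lambda>a. {f \<in> labelsets L 2. f \<inter> e = {a}}"
  have split: "labelsets L 2 - {e} = ?D \<union> (\<Union>a\<in>e. ?J a)" (is "?l = ?r")
  proof
    show "?r \<subseteq> ?l"
      using eL by auto
    show "?l \<subseteq> ?r"
    proof
      fix f assume f: "f \<in> ?l"
      then have f2: "card f = 2" "finite f" "f \<noteq> e"
        using L by (auto simp: labelsets_def intro: finite_subset)
      \<comment> \<open>Containment between two sets of size 2 would force equality; hence the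
        intersection has at most one element.\<close>
      have "\<not> f \<subseteq> e"
        using card_subset_eq[of e f] f2 eL by auto
      then have "f \<inter> e \<subset> f"
        by blast
      then have "card (f \<inter> e) < 2"
        using f2 psubset_card_mono by metis
      then have "card (f \<inter> e) = 0 \<or> card (f \<inter> e) = 1"
        by linarith
      then have "f \<inter> e = {} \<or> (\<exists>a. f \<inter> e = {a})"
        using f2 by (auto simp: card_1_singleton_iff)
      then show "f \<in> ?r"
        using f by blast
    qed
  qed
  \<comment> \<open>Pairs are labelsets of size 2, so the trace count applies to them as well, with
    \<open>T = e\<close> and trace empty or \<open>{a}\<close>.\<close>
  have cD: "card ?D = (card L - 2) choose 2"
    using card_labelsets_trace[OF L eL(1), of "{}" 2] cL eL binom_of_nat[of "card L - 2" 2]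
    by (simp add: of_nat_diff)
  have cJ: "card (?J a) = card L - 2" if "a \<in> e" for a
    using card_labelsets_trace[OF L eL(1), of "{a}" 2] cL eL that binom_of_nat[of "card L - 2" 1]
    by (simp add: of_nat_diff)
  have "(\<Sum>f\<in>labelsets L 2 - {e}. g f) = sum g ?D + (\<Sum>a\<in>e. sum g (?J a))"
    unfolding split using eL finite_labelsets[OF L]
    by (subst sum.union_disjoint) (auto intro!: sum.UNION_disjoint)
  also have "sum g ?D = (\<Sum>f\<in>?D. u)"
    by (intro sum.cong refl disj) auto
  also have "(\<Sum>a\<in>e. sum g (?J a)) = (\<Sum>a\<in>e. \<Sum>f\<in>?J a. v)"
    by (intro sum.cong refl adj) (auto simp: Int_commute)
  also have "\<dots> = (\<Sum>a\<in>e. (real (card L) - 2) * v)"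
    using cJ cL by (intro sum.cong) (auto simp: of_nat_diff)
  finally show ?thesis
    using cD eL by simp
qed

section \<open>Probabilities for independent uniform draws\<close>

text \<open>Independence factors the probability over the draws, and by uniformity each factor is
  the proportion of labelsets satisfying \<open>Q\<close>. This reduces every later probability to a
  count.\<close>

lemma measure_iid_labelsets:
  assumes "prob_space M" and L: "finite L" and \<alpha>: "1 \<le> \<alpha>"
    and X: "iid_uniform_labelsets M \<alpha> L n X"
  shows "{\<omega> \<in> space M. \<forall>i<\<alpha>. Q (X i \<omega>)} \<in> sets M"
    and "measure M {\<omega> \<in> space M. \<forall>i<\<alpha>. Q (X i \<omega>)}
       = (real (card {A \<in> labelsets L n. Q A}) / real (card L choose n)) ^ \<alpha>"
proof -
  interpret prob_space M by fact
  let ?S = "labelsets L n"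
  let ?G = "{A \<in> ?S. Q A}"
  have ind: "indep_vars (\<lambda>_. count_space ?S) X {..<\<alpha>}"
    and dis: "\<And>i. i < \<alpha> \<Longrightarrow> distr M (count_space ?S) (X i) = uniform_count_measure ?S"
    using X by (auto simp: iid_uniform_labelsets_def)
  have meas: "X i \<in> measurable M (count_space ?S)" if "i < \<alpha>" for i
    using ind that by (auto simp: indep_vars_def)
  have "0 \<in> {..<\<alpha>}"
    using \<alpha> by simp
  \<comment> \<open>An intersection over no draws would be \<open>UNIV\<close> instead of
    \<open>space M\<close>; the rules for finite intersections and independence also ask for a
    nonempty index set.\<close>
  then have ne: "{..<\<alpha>} \<noteq> {}"
    by blast
  have eq: "{\<omega> \<in> space M. \<forall>i<\<alpha>. Q (X i \<omega>)} = (\<Inter>i\<in>{..<\<alpha>}. X i -` ?G \<inter> space M)"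
    using ne by (auto dest: measurable_space[OF meas])
  have one: "prob (X i -` ?G \<inter> space M) = card ?G / (card L choose n)" if "i < \<alpha>" for i
  proof -
    have "prob (X i -` ?G \<inter> space M) = measure (distr M (count_space ?S) (X i)) ?G"
      using meas[OF that] by (subst measure_distr) auto
    also have "\<dots> = card ?G / card ?S"
      using finite_labelsets[OF L] that by (simp add: dis measure_uniform_count_measure)
    finally show ?thesis
      by (simp add: card_labelsets L)
  qed
  show "{\<omega> \<in> space M. \<forall>i<\<alpha>. Q (X i \<omega>)} \<in> sets M"
    unfolding eq using ne meas by (intro sets.finite_INT measurable_sets) auto
  have "measure M {\<omega> \<in> space M. \<forall>i<\<alpha>. Q (X i \<omega>)} = (\<Prod>i<\<alpha>. prob (X i -` ?G \<inter> space M))"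
    unfolding eq using ne by (intro indep_varsD[OF ind]) auto
  also have "\<dots> = (\<Prod>i<\<alpha>. card ?G / (card L choose n))"
    using one by (intro prod.cong) auto
  finally show "measure M {\<omega> \<in> space M. \<forall>i<\<alpha>. Q (X i \<omega>)}
      = (real (card ?G) / real (card L choose n)) ^ \<alpha>"
    by simp
qed

section \<open>Evaluation of \<open>S1\<close> and \<open>S2\<close>, and the bound on
  coverage\<close>

lemma real_choose_two: "real (m choose 2) = real m * (real m - 1) / 2"
  by (simp add: binomial_gbinomial gbinomial_prod_rev numeral_2_eq_2)

lemma real_choose_three: "real (m choose 3) = real m * (real m - 1) * (real m - 2) / 6"
  by (simp add: binomial_gbinomial gbinomial_prod_rev numeral_3_eq_3 fact_numeral)

lemma S1_nonneg: "0 \<le> S1 N n \<alpha>"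
  by (simp add: S1_def)

text \<open>The factor \<open>(real N - 3) / 4\<close> is negative for \<open>N < 3\<close>, but
  there \<open>binom N 3\<close> vanishes.\<close>

lemma S2_nonneg: "0 \<le> S2 N n \<alpha>"
proof (cases "3 \<le> N")
  case False
  then show ?thesis
    by (simp add: S2_def binom_def)
qed (simp add: S2_def)

theorem lemma1:
  fixes N n \<alpha> :: nat
    and lam :: "nat \<Rightarrow> 'l"
    and M :: "'w measure"
    and X :: "nat \<Rightarrow> 'w \<Rightarrow> 'l set"
  assumes "2 \<le> N" and "1 \<le> \<alpha>" and "1 \<le> n" and "n < N"
    and "inj_on lam {1..N}"
    and "prob_space M"
    and "iid_uniform_labelsets M \<alpha> (lam ` {1..N}) n X"
  shows "measure M {\<omega> \<in> space M. \<forall>a b. 1 \<le> a \<and> a < b \<and> b \<le> N \<longrightarrow>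
                      (\<exists>i<\<alpha>. {lam a, lam b} \<subseteq> X i \<omega>)}
         \<le> 1 - 2 * ((real_of_int (delta N n \<alpha>) - 1) * S1 N n \<alpha> - S2 N n \<alpha>)
               / (real_of_int (delta N n \<alpha>) * (real_of_int (delta N n \<alpha>) - 1))"
proof -
  interpret prob_space M by fact
  define L where "L = lam ` {1..N}"
  have L: "finite L" "card L = N"
    using assms(5) by (auto simp: L_def card_image)
  note iid = measure_iid_labelsets[OF assms(6) L(1) assms(2) assms(7)[folded L_def]]
  define P where "P = labelsets L 2"
  \<comment> \<open>\<open>U e\<close> is the event that the pair \<open>e\<close> stays uncovered.
    Below, \<open>c\<close> counts all labelsets, and \<open>p\<close>, \<open>u\<close>,
    \<open>v\<close> count those avoiding one pair, two disjoint pairs and two adjacent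
    pairs.\<close>
  define U where "U e = {\<omega> \<in> space M. \<forall>i<\<alpha>. \<not> e \<subseteq> X i \<omega>}" for e
  define c where "c = real (N choose n)"
  define p where "p = real (binom (int N - 2) n + 2 * binom (int N - 2) (int n - 1))"
  define u where "u = real (binom (int N - 4) n + 4 * binom (int N - 4) (int n - 1)
                        + 4 * binom (int N - 4) (int n - 2))"
  define v where "v = real (binom (int N - 3) n + 3 * binom (int N - 3) (int n - 1)
                        + binom (int N - 3) (int n - 2))"
  have U: "U e \<in> events" for e
    unfolding U_def by (rule iid(1))
  have P: "finite P" "card P = N choose 2"
    using L by (auto simp: P_def finite_labelsets card_labelsets)
  have prob1: "prob (U e) = (p / c) ^ \<alpha>" if "e \<in> P" for e
    using that L unfolding U_def iid(2)[of "\<lambda>A. \<not> e \<subseteq> A"]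
    by (simp add: card_avoid_pair P_def p_def c_def)
  \<comment> \<open>The intersection again imposes one condition on every single draw, so the
    product formula applies to it.\<close>
  have UI: "U e \<inter> U f = {\<omega> \<in> space M. \<forall>i<\<alpha>. \<not> e \<subseteq> X i \<omega> \<and> \<not> f \<subseteq> X i \<omega>}" for e f
    by (auto simp: U_def)
  have disj: "prob (U e \<inter> U f) = (u / c) ^ \<alpha>" if ef: "e \<in> P" "f \<in> P" "e \<inter> f = {}" for e f
  proof -
    obtain a b where "e = {a, b}" "a \<noteq> b"
      using ef(1) by (auto simp: P_def labelsets_def card_2_iff)
    moreover obtain a' b' where "f = {a', b'}" "a' \<noteq> b'"
      using ef(2) by (auto simp: P_def labelsets_def card_2_iff)
    ultimately show ?thesis
      using ef L card_avoid_disjoint_pairs[OF L(1), of a b a' b' n]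
      unfolding UI iid(2)[of "\<lambda>A. \<not> e \<subseteq> A \<and> \<not> f \<subseteq> A"]
      by (auto simp: P_def labelsets_def u_def c_def)
  qed
  have adj: "prob (U e \<inter> U f) = (v / c) ^ \<alpha>" if ef: "e \<in> P" "f \<in> P" "card (e \<inter> f) = 1" for e f
  proof -
    obtain a where a: "e \<inter> f = {a}"
      using ef by (auto simp: card_1_singleton_iff)
    then have "a \<in> e" "a \<in> f" by auto
    then obtain b b' where "e = {a, b}" "a \<noteq> b" "f = {a, b'}" "a \<noteq> b'"
      using ef by (auto simp: P_def labelsets_def card_2_iff)
    moreover from this have "b \<noteq> b'"
      using a by auto
    ultimately show ?thesis
      using ef L card_avoid_adjacent_pairs[OF L(1), of a b b' n]
      unfolding UI iid(2)[of "\<lambda>A. \<not> e \<subseteq> A \<and> \<not> f \<subseteq> A"]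
      by (auto simp: P_def labelsets_def v_def c_def)
  qed
  have bc: "binom (int N) (int n) = N choose n" "binom (int N) 2 = N choose 2"
    "binom (int N) 3 = N choose 3"
    using binom_of_nat[of N n] binom_of_nat[of N 2] binom_of_nat[of N 3] by simp_all
  have S1: "(\<Sum>e\<in>P. prob (U e)) = S1 N n \<alpha>"
    using P by (simp add: prob1 S1_def bc p_def c_def)
  have "(\<Sum>f\<in>P - {e}. prob (U e \<inter> U f))
      = real ((N - 2) choose 2) * (u / c) ^ \<alpha> + 2 * (real N - 2) * (v / c) ^ \<alpha>" if "e \<in> P" for e
    using sum_over_other_pairs[OF L(1), of e "\<lambda>f. prob (U e \<inter> U f)"] that disj adj L
    unfolding P_def by auto
  then have "(\<Sum>e\<in>P. \<Sum>f\<in>P - {e}. prob (U e \<inter> U f))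
      = real (N choose 2)
        * (real ((N - 2) choose 2) * (u / c) ^ \<alpha> + 2 * (real N - 2) * (v / c) ^ \<alpha>)"
    using P by simp
  \<comment> \<open>The factor 2 arises because the double sum meets each unordered pair of events
    twice.\<close>
  also have "\<dots> = 2 * S2 N n \<alpha>"
  proof -
    have "S2 N n \<alpha> = 3 * real (N choose 3) / c ^ \<alpha> * ((real N - 3) / 4 * u ^ \<alpha> + v ^ \<alpha>)"
      by (simp add: S2_def bc u_def v_def c_def)
    also have "\<dots> = 3 * real (N choose 3) * ((real N - 3) / 4 * (u / c) ^ \<alpha> + (v / c) ^ \<alpha>)"
      by (simp add: power_divide add_divide_distrib distrib_left)
    finally have S2_eq: "S2 N n \<alpha> = \<dots>" .
    \<comment> \<open>Comparing coefficients: both sides have \<open>N(N-1)(N-2)(N-3)/4\<close> at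
      \<open>x\<close> and \<open>N(N-1)(N-2)\<close> at \<open>y\<close>.\<close>
    have "real (N choose 2) * (real ((N - 2) choose 2) * x + 2 * (real N - 2) * y)
        = 2 * (3 * real (N choose 3) * ((real N - 3) / 4 * x + y))" for x y :: real
      using assms(1) by (simp add: real_choose_two real_choose_three of_nat_diff field_simps)
    then show ?thesis
      by (simp only: S2_eq)
  qed
  finally have S2: "(\<Sum>e\<in>P. \<Sum>f\<in>P - {e}. prob (U e \<inter> U f)) / 2 = S2 N n \<alpha>"
    by simp
  \<comment> \<open>The floor is taken of a quotient of nonnegative reals, which is nonnegative also
    under the convention \<open>x / 0 = 0\<close>.\<close>
  have "2 \<le> delta N n \<alpha>"
    using S1_nonneg[of N n \<alpha>] S2_nonneg[of N n \<alpha>] by (simp add: delta_def)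
  from dawson_sankoff[of P U, OF P(1) U this]
  have bound: "2 * ((real_of_int (delta N n \<alpha>) - 1) * S1 N n \<alpha> - S2 N n \<alpha>)
               / (real_of_int (delta N n \<alpha>) * (real_of_int (delta N n \<alpha>) - 1))
      \<le> prob (\<Union>e\<in>P. U e)"
    by (simp only: S1 S2)
  \<comment> \<open>Injectivity of \<open>lam\<close> makes two distinct indices give a set of size
    2; swapping the indices if necessary gives \<open>a < b\<close>.\<close>
  have pairs: "P = {{lam a, lam b} |a b. 1 \<le> a \<and> a < b \<and> b \<le> N}"
  proof (intro equalityI subsetI)
    fix e assume "e \<in> P"
    then obtain x y where xy: "e = {x, y}" "x \<noteq> y" "x \<in> L" "y \<in> L"
      by (auto simp: P_def labelsets_def card_2_iff)
    then obtain a b where "x = lam a" "y = lam b" "a \<in> {1..N}" "b \<in> {1..N}"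
      by (auto simp: L_def)
    with xy have ab: "e = {lam a, lam b}" "a \<noteq> b" "a \<in> {1..N}" "b \<in> {1..N}"
      by auto
    show "e \<in> {{lam a, lam b} |a b. 1 \<le> a \<and> a < b \<and> b \<le> N}"
    proof (cases "a < b")
      case True
      with ab show ?thesis by auto
    next
      case False
      with ab have "e = {lam b, lam a}" "1 \<le> b \<and> b < a \<and> a \<le> N" by auto
      then show ?thesis by blast
    qed
  next
    fix e assume "e \<in> {{lam a, lam b} |a b. 1 \<le> a \<and> a < b \<and> b \<le> N}"
    then obtain a b where ab: "e = {lam a, lam b}" "1 \<le> a" "a < b" "b \<le> N"
      by auto
    then have "lam a \<noteq> lam b"
      using inj_onD[OF assms(5), of a b] by auto
    with ab show "e \<in> P"
      by (auto simp: P_def L_def labelsets_def)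
  qed
  \<comment> \<open>Full coverage is the complement of the union of the \<open>U e\<close>, so the
    lower bound for the union becomes the upper bound sought.\<close>
  have "{\<omega> \<in> space M. \<forall>a b. 1 \<le> a \<and> a < b \<and> b \<le> N \<longrightarrow> (\<exists>i<\<alpha>. {lam a, lam b} \<subseteq> X i \<omega>)}
      = space M - (\<Union>e\<in>P. U e)"
    unfolding pairs U_def by blast
  moreover have "(\<Union>e\<in>P. U e) \<in> events"
    using U P(1) by auto
  ultimately show ?thesis
    using bound by (simp add: prob_compl)
qed

end
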